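(* Let $m\ge2$ and $K>0$. A Kropina space $(\mathbb{S}^{2m-1},F)$ of constant flag curvature $K$, i.e. one induced by navigation data $(h,W)$ with $h$ equal to $\frac1K$ times the standard metric of the unit sphere and $W$ a unit length Killing vector field of $(\mathbb{S}^{2m-1},h)$, cannot be projectively flat.
   Context: Kropina space induced by navigation data $(h,W)$ (with $h(W,W)=1$): the conic Finsler metric $F(x,y)=\frac{h(y,y)}{2h(y,W)}$ on $A=\{(x,y)\in TM: h(y,W_x)>0\}$. A conic Finsler metric $F:A\to(0,\infty)$ is projectively flat if it is with rectilinear extremals, i.e. the manifold is covered by coordinate neighborhoods in which its geodesics are straight lines as point sets; equivalently in these coordinates Hamel's relation $\frac{\partial^2F}{\partial x^r\partial y^j}y^r-\frac{\partial F}{\partial x^j}=0$ holds for all $(x,y)\in A$. *)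

theory Defs
  imports "HOL-Analysis.Analysis"
begin

primrec Ck_on :: "nat \<Rightarrow> 'a::real_normed_vector set \<Rightarrow> ('a \<Rightarrow> 'b::real_normed_vector) \<Rightarrow> bool" where
  "Ck_on 0 S f \<longleftrightarrow> continuous_on S f"
| "Ck_on (Suc k) S f \<longleftrightarrow>
     (\<forall>x\<in>S. f differentiable at x) \<and> (\<forall>v. Ck_on k S (\<lambda>x. frechet_derivative f (at x) v))"

text \<open>\<^term>\<open>Ck_on\<close> uses two-sided derivatives, so the next notion is meant for open \<open>S\<close>.\<close>

definition smooth_on :: "'a::real_normed_vector set \<Rightarrow> ('a \<Rightarrow> 'b::real_normed_vector) \<Rightarrow> bool" where
  "smooth_on S f \<longleftrightarrow> (\<forall>k. Ck_on k S f)"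

section \<open>The unit sphere as a manifold\<close>

text \<open>
  The sphere is \<^term>\<open>sphere 0 1\<close> in a Euclidean space. A map \<open>f\<close> on an open part \<open>U\<close> of the sphere
  is extended to the open cone over \<open>U\<close> by \<open>x \<mapsto> f (sgn x)\<close>, where \<open>sgn x = x / norm x\<close>; since \<open>sgn\<close>
  is a smooth retraction onto the sphere, \<open>f\<close> is smooth as a map on the manifold iff its extension is.
\<close>

definition smooth_on_sphere ::
    "'a::euclidean_space set \<Rightarrow> ('a \<Rightarrow> 'b::real_normed_vector) \<Rightarrow> bool" where
  "smooth_on_sphere U f \<longleftrightarrow> smooth_on {x. sgn x \<in> U} (\<lambda>x. f (sgn x))"

definition tangent_sphere :: "'a::euclidean_space \<Rightarrow> 'a set" where
  "tangent_sphere x = {v. v \<bullet> x = 0}"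

definition sphere_vector_field :: "('a::euclidean_space \<Rightarrow> 'a) \<Rightarrow> bool" where
  "sphere_vector_field W \<longleftrightarrow>
     smooth_on_sphere (sphere 0 1) W \<and> (\<forall>x\<in>sphere 0 1. W x \<in> tangent_sphere x)"

text \<open>
  A coordinate neighbourhood \<open>U\<close> with coordinate map \<open>\<phi>\<close> onto the open set \<open>V\<close>, and inverse \<open>\<psi>\<close>.
\<close>

definition sphere_chart ::
    "'a::euclidean_space set \<Rightarrow> 'b::euclidean_space set \<Rightarrow> ('a \<Rightarrow> 'b) \<Rightarrow> ('b \<Rightarrow> 'a) \<Rightarrow> bool" where
  "sphere_chart U V \<phi> \<psi> \<longleftrightarrow>
     openin (top_of_set (sphere 0 1)) U \<and> open V \<and> homeomorphism U V \<phi> \<psi> \<and>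
     smooth_on_sphere U \<phi> \<and> smooth_on V \<psi>"

section \<open>Killing fields and Kropina metrics\<close>

definition round_metric :: "real \<Rightarrow> 'a::euclidean_space \<Rightarrow> 'a \<Rightarrow> 'a \<Rightarrow> real" where
  "round_metric K x u v = (1 / K) * (u \<bullet> v)"

text \<open>
  The classical formula for the Lie derivative of a metric,
  \<open>(L\<^sub>W h)\<^sub>i\<^sub>j = W\<^sup>k \<partial>\<^sub>k h\<^sub>i\<^sub>j + h\<^sub>k\<^sub>j \<partial>\<^sub>i W\<^sup>k + h\<^sub>i\<^sub>k \<partial>\<^sub>j W\<^sup>k\<close>, in the Cartesian coordinates of the
  surrounding space, with \<open>h\<close> and \<open>W\<close> extended off the sphere as above. As \<open>W\<close> is tangent to the
  sphere, Lie derivative and restriction to the sphere commute, so for tangent \<open>u\<close>, \<open>v\<close> the value is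
  that of the Lie derivative on the sphere, whatever the extension.
\<close>

definition lie_derivative_metric ::
    "('a::euclidean_space \<Rightarrow> 'a) \<Rightarrow> ('a \<Rightarrow> 'a \<Rightarrow> 'a \<Rightarrow> real) \<Rightarrow> 'a \<Rightarrow> 'a \<Rightarrow> 'a \<Rightarrow> real" where
  "lie_derivative_metric W h x u v =
     frechet_derivative (\<lambda>z. h (sgn z) u v) (at x) (W x)
     + h x (frechet_derivative (\<lambda>z. W (sgn z)) (at x) u) v
     + h x u (frechet_derivative (\<lambda>z. W (sgn z)) (at x) v)"

definition killing_field ::
    "('a::euclidean_space \<Rightarrow> 'a \<Rightarrow> 'a \<Rightarrow> real) \<Rightarrow> ('a \<Rightarrow> 'a) \<Rightarrow> bool" where
  "killing_field h W \<longleftrightarrow> sphere_vector_field W \<and>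
     (\<forall>x\<in>sphere 0 1. \<forall>u\<in>tangent_sphere x. \<forall>v\<in>tangent_sphere x. lie_derivative_metric W h x u v = 0)"

definition kropina_metric ::
    "('a::euclidean_space \<Rightarrow> 'a \<Rightarrow> 'a \<Rightarrow> real) \<Rightarrow> ('a \<Rightarrow> 'a) \<Rightarrow> 'a \<Rightarrow> 'a \<Rightarrow> real" where
  "kropina_metric h W x y = h x y y / (2 * h x y (W x))"

definition kropina_domain ::
    "('a::euclidean_space \<Rightarrow> 'a \<Rightarrow> 'a \<Rightarrow> real) \<Rightarrow> ('a \<Rightarrow> 'a) \<Rightarrow> ('a \<times> 'a) set" where
  "kropina_domain h W = {(x, y). x \<in> sphere 0 1 \<and> y \<in> tangent_sphere x \<and> h x y (W x) > 0}"

section \<open>Projective flatness\<close>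

definition coord_metric ::
    "('b::euclidean_space \<Rightarrow> 'a::euclidean_space) \<Rightarrow> ('a \<Rightarrow> 'a \<Rightarrow> real) \<Rightarrow> 'b \<Rightarrow> 'b \<Rightarrow> real" where
  "coord_metric \<psi> F x y = F (\<psi> x) (frechet_derivative \<psi> (at x) y)"

definition coord_domain ::
    "'b::euclidean_space set \<Rightarrow> ('b \<Rightarrow> 'a::euclidean_space) \<Rightarrow> ('a \<times> 'a) set \<Rightarrow> ('b \<times> 'b) set" where
  "coord_domain V \<psi> A = {(x, y). x \<in> V \<and> (\<psi> x, frechet_derivative \<psi> (at x) y) \<in> A}"

text \<open>
  Geodesics are the admissible extremals of the length functional \<open>\<integral> F(c, c') dt\<close>, i.e. the solutions
  of the Euler-Lagrange equations \<open>d/dt (\<partial>F/\<partial>y\<^sup>j (c, c')) = \<partial>F/\<partial>x\<^sup>j (c, c')\<close>. The parametrisation is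
  left free: the equations are invariant under orientation preserving reparametrisation.
\<close>

definition is_geodesic ::
    "('b::euclidean_space \<Rightarrow> 'b \<Rightarrow> real) \<Rightarrow> ('b \<times> 'b) set \<Rightarrow> (real \<Rightarrow> 'b) \<Rightarrow> real \<Rightarrow> real \<Rightarrow> bool" where
  "is_geodesic F A c a b \<longleftrightarrow>
     a < b \<and> smooth_on {a<..<b} c \<and>
     (\<forall>t\<in>{a<..<b}. (c t, vector_derivative c (at t)) \<in> A \<and>
        (\<forall>e\<in>Basis. ((\<lambda>s. frechet_derivative (F (c s)) (at (vector_derivative c (at s))) e)
            has_real_derivative
              frechet_derivative (\<lambda>x. F x (vector_derivative c (at t))) (at (c t)) e) (at t)))"

text \<open>
  The first argument fixes the coordinate space \<open>'b\<close> of the charts. Zero vectors are not admissible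
  for a Kropina metric, so geodesics are regular and a collinear image is an open line segment.
\<close>

definition projectively_flat ::
    "'b::euclidean_space itself \<Rightarrow> ('a::euclidean_space \<Rightarrow> 'a \<Rightarrow> real) \<Rightarrow> ('a \<times> 'a) set \<Rightarrow> bool" where
  "projectively_flat _ F A \<longleftrightarrow>
     (\<forall>p\<in>sphere 0 1. \<exists>U V \<phi> (\<psi> :: 'b \<Rightarrow> 'a). sphere_chart U V \<phi> \<psi> \<and> p \<in> U \<and>
        (\<forall>c a b. is_geodesic (coord_metric \<psi> F) (coord_domain V \<psi> A) c a b \<longrightarrow>
           collinear (c ` {a<..<b})))"

end

theory Submission
  imports Defs
begin

text \<open>
  A Killing field has constant inner product with the velocity of a great circle, so a unit one is
  \<open>W x = \<surd>K J x\<close> with \<open>J\<close> an orthogonal complex structure. The circle in which a complex line meets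
  the sphere satisfies the Euler-Lagrange equations of \<open>F\<close>, so it is a closed geodesic. As \<open>m \<ge> 2\<close>,
  complex lines which are nearly tangent to the sphere yield arbitrarily small such circles, in
  particular some inside any chart. In a chart with straight geodesics the circle would be a closed
  regular curve on a line, which Rolle's theorem excludes.
\<close>

section \<open>Functions of class \<open>C\<^sup>k\<close>\<close>

lemma Ck_on_SucD: "Ck_on (Suc k) S f \<Longrightarrow> Ck_on k S f"
proof (induction k arbitrary: f)
  case 0
  then show ?case
    by (auto intro!: continuous_at_imp_continuous_on differentiable_imp_continuous_within)
next
  case (Suc k)
  then show ?case
    by (metis Ck_on.simps(2))
qed

text \<open>On an open set a two-sided derivative depends only on the values inside the set, so
  agreement of the functions passes to their derivatives by induction.\<close>

lemma Ck_on_cong: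
  assumes "open S" and "\<And>x. x \<in> S \<Longrightarrow> f x = g x" and "Ck_on k S f"
  shows "Ck_on k S g"
  using assms(2,3)
proof (induction k arbitrary: f g)
  case 0
  then show ?case by (simp cong: continuous_on_cong)
next
  case (Suc k)
  have diff: "g differentiable at x" if "x \<in> S" for x
    using Suc.prems that assms(1)
    by (metis Ck_on.simps(2) differentiable_def has_derivative_transform_within_open)
  moreover have "Ck_on k S (\<lambda>x. frechet_derivative g (at x) v)" for v
  proof (rule Suc.IH)
    show "Ck_on k S (\<lambda>x. frechet_derivative f (at x) v)"
      using Suc.prems by simp
    show "frechet_derivative f (at x) v = frechet_derivative g (at x) v" if "x \<in> S" for x
      using frechet_derivative_transform_within_open[of f x S g] Suc.prems that assms(1) by simp
  qed
  ultimately show ?case by simp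
qed

text \<open>Derivatives are unique, so an explicit formula \<open>f'\<close> may stand in for
  \<open>frechet_derivative\<close>. The closure properties below then follow from the usual
  derivative rules and induction on the order.\<close>

lemma Ck_on_SucI:
  assumes "open S" and "\<And>x. x \<in> S \<Longrightarrow> (f has_derivative f' x) (at x)"
    and "\<And>v. Ck_on k S (\<lambda>x. f' x v)"
  shows "Ck_on (Suc k) S f"
proof -
  have "Ck_on k S (\<lambda>x. frechet_derivative f (at x) v)" for v
    by (rule Ck_on_cong[OF assms(1) _ assms(3)]) (simp add: frechet_derivative_at[OF assms(2), symmetric])
  then show ?thesis
    using assms(2) by (auto simp: differentiable_def)
qed

lemma Ck_on_Suc_has_derivative:
  "Ck_on (Suc k) S f \<Longrightarrow> x \<in> S \<Longrightarrow> (f has_derivative frechet_derivative f (at x)) (at x)"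
  by (simp add: frechet_derivative_works)

lemma Ck_on_const: "Ck_on k S (\<lambda>x. a)"
  by (induction k arbitrary: a) auto

lemma Ck_on_add:
  assumes "open S" "Ck_on k S f" "Ck_on k S g"
  shows "Ck_on k S (\<lambda>x. f x + g x)"
  using assms(2,3)
proof (induction k arbitrary: f g)
  case 0
  then show ?case by (simp add: continuous_on_add)
next
  case (Suc k)
  show ?case
    by (rule Ck_on_SucI[OF assms(1) has_derivative_add[OF Ck_on_Suc_has_derivative Ck_on_Suc_has_derivative]])
      (use Suc in auto)
qed

lemma Ck_on_sum:
  assumes "open S" "\<And>i. i \<in> I \<Longrightarrow> Ck_on k S (f i)"
  shows "Ck_on k S (\<lambda>x. \<Sum>i\<in>I. f i x)"
  using assms(2)
  by (induction I rule: infinite_finite_induct) (auto intro: Ck_on_const Ck_on_add[OF assms(1)])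

lemma Ck_on_scaleR:
  assumes "open S" "Ck_on k S f" "Ck_on k S g"
  shows "Ck_on k S (\<lambda>x. f x *\<^sub>R g x)"
  using assms(2,3)
proof (induction k arbitrary: f g)
  case 0
  then show ?case by (simp add: continuous_on_scaleR)
next
  case (Suc k)
  show ?case
  proof (rule Ck_on_SucI[OF assms(1) has_derivative_scaleR[OF Ck_on_Suc_has_derivative Ck_on_Suc_has_derivative]])
    show "Ck_on k S (\<lambda>x. f x *\<^sub>R frechet_derivative g (at x) v + frechet_derivative f (at x) v *\<^sub>R g x)" for v
      using Suc.prems Ck_on_SucD[OF Suc.prems(1)] Ck_on_SucD[OF Suc.prems(2)]
      by (intro Ck_on_add[OF assms(1)] Suc.IH) auto
  qed (use Suc in auto)
qed

lemma Ck_on_inner_left: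
  assumes "open S" "Ck_on k S f"
  shows "Ck_on k S (\<lambda>x. f x \<bullet> a)"
  using assms(2)
proof (induction k arbitrary: f)
  case 0
  then show ?case by (auto intro!: continuous_intros)
next
  case (Suc k)
  show ?case
    by (rule Ck_on_SucI[OF assms(1) has_derivative_inner_left[OF Ck_on_Suc_has_derivative]])
      (use Suc in auto)
qed

text \<open>In the chain rule the direction fed to the derivative of \<open>f\<close> varies with
  \<open>x\<close>, whereas \<open>Ck_on\<close> speaks of fixed directions. Expanding that
  direction in \<open>Basis\<close> leaves a finite sum of products of functions of class
  \<open>k\<close>.\<close>

lemma Ck_on_compose:
  fixes g :: "'a::real_normed_vector \<Rightarrow> 'b::euclidean_space"
  assumes "open T" "g ` T \<subseteq> S" "Ck_on k T g" "Ck_on k S f"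
  shows "Ck_on k T (\<lambda>x. f (g x))"
  using assms(3,4)
proof (induction k arbitrary: f)
  case 0
  then show ?case using continuous_on_compose2 assms(2) by (metis Ck_on.simps(1))
next
  case (Suc k)
  let ?D = "\<lambda>x v. \<Sum>i\<in>Basis. (frechet_derivative g (at x) v \<bullet> i) *\<^sub>R frechet_derivative f (at (g x)) i"
  show ?case
  proof (rule Ck_on_SucI[OF assms(1)])
    fix x assume x: "x \<in> T"
    have f: "(f has_derivative frechet_derivative f (at (g x))) (at (g x))"
      using Ck_on_Suc_has_derivative[OF Suc.prems(2)] x assms(2) by auto
    have lin: "linear (frechet_derivative f (at (g x)))"
      using f has_derivative_linear by blast
    have "frechet_derivative f (at (g x)) w
        = (\<Sum>i\<in>Basis. (w \<bullet> i) *\<^sub>R frechet_derivative f (at (g x)) i)" for w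
    proof -
      have "frechet_derivative f (at (g x)) (\<Sum>i\<in>Basis. (w \<bullet> i) *\<^sub>R i)
          = (\<Sum>i\<in>Basis. (w \<bullet> i) *\<^sub>R frechet_derivative f (at (g x)) i)"
        by (simp only: linear_sum[OF lin] linear_cmul[OF lin])
      then show ?thesis by (simp only: euclidean_representation)
    qed
    then have "(\<lambda>v. frechet_derivative f (at (g x)) (frechet_derivative g (at x) v)) = ?D x"
      by blast
    then show "((\<lambda>x. f (g x)) has_derivative ?D x) (at x)"
      using has_derivative_compose[OF Ck_on_Suc_has_derivative[OF Suc.prems(1) x] f] by metis
  next
    fix v
    show "Ck_on k T (\<lambda>x. ?D x v)"
    proof (intro Ck_on_sum Ck_on_scaleR Ck_on_inner_left assms(1))
      show "Ck_on k T (\<lambda>x. frechet_derivative g (at x) v)"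
        using Suc.prems(1) by simp
      show "Ck_on k T (\<lambda>x. frechet_derivative f (at (g x)) i)" for i
        using Suc.IH[OF Ck_on_SucD[OF Suc.prems(1)], of "\<lambda>y. frechet_derivative f (at y) i"]
          Suc.prems(2) by simp
    qed
  qed
qed

text \<open>Each derivative is a curve of the same kind, with centre 0 and new axes, so the
  induction runs over all \<open>a\<close>, \<open>b\<close>, \<open>d\<close> at once.\<close>

lemma smooth_on_ellipse:
  assumes "open S"
  shows "smooth_on S (\<lambda>t. a + cos t *\<^sub>R b + sin t *\<^sub>R d)"
proof -
  have "Ck_on k S (\<lambda>t. a + cos t *\<^sub>R b + sin t *\<^sub>R d)" for k
  proof (induction k arbitrary: a b d)
    case 0
    then show ?case by (auto intro!: continuous_intros)
  next
    case (Suc k)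
    show ?case
    proof (rule Ck_on_SucI[OF assms])
      show "((\<lambda>t. a + cos t *\<^sub>R b + sin t *\<^sub>R d) has_derivative
          (\<lambda>v. 0 + cos t *\<^sub>R v *\<^sub>R d + sin t *\<^sub>R (- v *\<^sub>R b))) (at t)" for t
        by (auto intro!: derivative_eq_intros simp: fun_eq_iff algebra_simps)
    qed (rule Suc)
  qed
  then show ?thesis by (simp add: smooth_on_def)
qed

section \<open>Symmetry of second derivatives\<close>

text \<open>The mean value theorem is applied twice to the second difference over the parallelogram
  with sides \<open>h *\<^sub>R u\<close> and \<open>h *\<^sub>R v\<close>: first along
  \<open>u\<close>, then along \<open>v\<close>.\<close>

lemma second_difference_mean_value:
  fixes f :: "'a::real_normed_vector \<Rightarrow> real"
  assumes "0 < h" and S: "\<And>s t. s \<in> {0..h} \<Longrightarrow> t \<in> {0..h} \<Longrightarrow> x + s *\<^sub>R u + t *\<^sub>R v \<in> S"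
    and f: "\<And>y. y \<in> S \<Longrightarrow> (f has_derivative f' y) (at y)"
    and g: "\<And>y. y \<in> S \<Longrightarrow> ((\<lambda>y. f' y u) has_derivative g y) (at y)"
  obtains s t where "s \<in> {0..h}" "t \<in> {0..h}"
    "f (x + h *\<^sub>R u + h *\<^sub>R v) - f (x + h *\<^sub>R u) - f (x + h *\<^sub>R v) + f x
      = h * h * g (x + s *\<^sub>R u + t *\<^sub>R v) v"
proof -
  \<comment> \<open>The summand \<open>0 *\<^sub>R v\<close> stays so that both terms are instances
    of \<open>f_shift\<close>, with \<open>t = h\<close> and \<open>t = 0\<close>.\<close>
  define k where "k s = f (x + s *\<^sub>R u + h *\<^sub>R v) - f (x + s *\<^sub>R u + 0 *\<^sub>R v)" for s
  have f_shift: "((\<lambda>s. f (x + s *\<^sub>R u + t *\<^sub>R v)) has_real_derivative f' (x + s *\<^sub>R u + t *\<^sub>R v) u) (at s)"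
    if "s \<in> {0..h}" "t \<in> {0..h}" for s t
  proof -
    note f = f[OF S[OF that]]
    have "((\<lambda>s. x + s *\<^sub>R u + t *\<^sub>R v) has_derivative (\<lambda>r. r *\<^sub>R u)) (at s)"
      by (auto intro!: derivative_eq_intros)
    from has_derivative_compose[OF this f] show ?thesis
      unfolding has_field_derivative_def
      using linear_cmul[OF has_derivative_linear[OF f]] by (simp add: mult_commute_abs)
  qed
  have "\<exists>s>0. s < h \<and> k h - k 0 = (h - 0) * (f' (x + s *\<^sub>R u + h *\<^sub>R v) u - f' (x + s *\<^sub>R u + 0 *\<^sub>R v) u)"
    by (rule MVT2[OF \<open>0 < h\<close>]) (unfold k_def, intro DERIV_diff f_shift, use \<open>0 < h\<close> in auto)
  then obtain s where s: "0 < s" "s < h"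
    "k h - k 0 = h * (f' (x + s *\<^sub>R u + h *\<^sub>R v) u - f' (x + s *\<^sub>R u + 0 *\<^sub>R v) u)"
    by auto
  have g_shift: "((\<lambda>t. f' (x + s *\<^sub>R u + t *\<^sub>R v) u) has_real_derivative g (x + s *\<^sub>R u + t *\<^sub>R v) v) (at t)"
    if "t \<in> {0..h}" for t
  proof -
    have g: "((\<lambda>y. f' y u) has_derivative g (x + s *\<^sub>R u + t *\<^sub>R v)) (at (x + s *\<^sub>R u + t *\<^sub>R v))"
      using s that by (intro g S) auto
    have "((\<lambda>t. x + s *\<^sub>R u + t *\<^sub>R v) has_derivative (\<lambda>r. r *\<^sub>R v)) (at t)"
      by (auto intro!: derivative_eq_intros)
    from has_derivative_compose[OF this g] show ?thesis
      unfolding has_field_derivative_def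
      using linear_cmul[OF has_derivative_linear[OF g]] by (simp add: mult_commute_abs)
  qed
  have "\<exists>t>0. t < h \<and> f' (x + s *\<^sub>R u + h *\<^sub>R v) u - f' (x + s *\<^sub>R u + 0 *\<^sub>R v) u
      = (h - 0) * g (x + s *\<^sub>R u + t *\<^sub>R v) v"
    by (rule MVT2[OF \<open>0 < h\<close>]) (auto intro: g_shift)
  then obtain t where "0 < t" "t < h"
    "f' (x + s *\<^sub>R u + h *\<^sub>R v) u - f' (x + s *\<^sub>R u + 0 *\<^sub>R v) u = h * g (x + s *\<^sub>R u + t *\<^sub>R v) v"
    by auto
  with s that[of s t] show thesis by (simp add: k_def)
qed

text \<open>The second difference does not change when \<open>u\<close> and \<open>v\<close> are
  exchanged. Divided by \<open>h * h\<close> it is a value of either mixed derivative near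
  \<open>x\<close>, so by continuity the two derivatives agree at \<open>x\<close>.\<close>

lemma second_derivative_symmetric_real:
  fixes f :: "'a::real_normed_vector \<Rightarrow> real"
  assumes "open S" "x \<in> S"
    and f: "\<And>y. y \<in> S \<Longrightarrow> (f has_derivative f' y) (at y)"
    and g: "\<And>y. y \<in> S \<Longrightarrow> ((\<lambda>y. f' y u) has_derivative g y) (at y)"
    and g': "\<And>y. y \<in> S \<Longrightarrow> ((\<lambda>y. f' y v) has_derivative g' y) (at y)"
    and cont: "continuous_on S (\<lambda>y. g y v)" "continuous_on S (\<lambda>y. g' y u)"
  shows "g x v = g' x u"
proof (rule ccontr)
  assume neq: "g x v \<noteq> g' x u"
  \<comment> \<open>Half the gap: no number lies at distance less than \<open>e\<close> from both
    sides.\<close>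
  define e where "e = \<bar>g x v - g' x u\<bar> / 2"
  have "e > 0" using neq by (simp add: e_def)
  have c: "isCont (\<lambda>y. g y v) x" "isCont (\<lambda>y. g' y u) x"
    using cont assms(1,2) by (simp_all add: continuous_on_eq_continuous_at)
  have "\<forall>\<^sub>F y in nhds x. y \<in> S \<and> dist (g y v) (g x v) < e \<and> dist (g' y u) (g' x u) < e"
    using c \<open>e > 0\<close> assms(1,2)
    by (intro eventually_conj eventually_nhds_in_open)
      (auto simp: isCont_def tendsto_iff eventually_at_filter elim!: eventually_mono)
  then obtain d where "d > 0"
    and d: "\<And>y. dist y x < d \<Longrightarrow> y \<in> S \<and> dist (g y v) (g x v) < e \<and> dist (g' y u) (g' x u) < e"
    by (auto simp: eventually_nhds_metric)
  \<comment> \<open>This keeps the parallelogram within \<open>d / 2\<close> of \<open>x\<close>;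
    the summand 1 makes the denominator positive even if \<open>u\<close> and \<open>v\<close>
    vanish.\<close>
  define h where "h = d / (2 * (norm u + norm v + 1))"
  have "h > 0" using \<open>d > 0\<close> by (simp add: h_def add_nonneg_pos)
  have near: "dist (x + s *\<^sub>R u + t *\<^sub>R v) x < d" if "s \<in> {0..h}" "t \<in> {0..h}" for s t
  proof -
    have "dist (x + s *\<^sub>R u + t *\<^sub>R v) x = norm (s *\<^sub>R u + t *\<^sub>R v)"
      by (simp add: dist_norm add.assoc)
    also have "\<dots> \<le> norm (s *\<^sub>R u) + norm (t *\<^sub>R v)"
      by (rule norm_triangle_ineq)
    also have "\<dots> \<le> h * norm u + h * norm v"
      using that by (auto intro!: add_mono mult_right_mono)
    also have "\<dots> \<le> h * (norm u + norm v + 1)"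
      using \<open>h > 0\<close> by (simp add: algebra_simps)
    also have "\<dots> = d / 2"
      by (simp add: h_def field_simps add_nonneg_eq_0_iff)
    also have "\<dots> < d" using \<open>d > 0\<close> by simp
    finally show ?thesis .
  qed
  obtain s t where st: "s \<in> {0..h}" "t \<in> {0..h}"
    "f (x + h *\<^sub>R u + h *\<^sub>R v) - f (x + h *\<^sub>R u) - f (x + h *\<^sub>R v) + f x
      = h * h * g (x + s *\<^sub>R u + t *\<^sub>R v) v"
    by (rule second_difference_mean_value[OF \<open>h > 0\<close>, of x u v S f f' g]) (use near d f g in auto)
  have near': "dist (x + s *\<^sub>R v + t *\<^sub>R u) x < d" if "s \<in> {0..h}" "t \<in> {0..h}" for s t
    using near[OF that(2,1)] by (simp add: algebra_simps)
  obtain s' t' where st': "s' \<in> {0..h}" "t' \<in> {0..h}"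
    "f (x + h *\<^sub>R v + h *\<^sub>R u) - f (x + h *\<^sub>R v) - f (x + h *\<^sub>R u) + f x
      = h * h * g' (x + s' *\<^sub>R v + t' *\<^sub>R u) u"
    by (rule second_difference_mean_value[OF \<open>h > 0\<close>, of x v u S f f' g']) (use near' d f g' in auto)
  have "h * h * g (x + s *\<^sub>R u + t *\<^sub>R v) v = h * h * g' (x + s' *\<^sub>R v + t' *\<^sub>R u) u"
  proof -
    have "x + h *\<^sub>R v + h *\<^sub>R u = x + h *\<^sub>R u + h *\<^sub>R v" by simp
    with st(3) st'(3) show ?thesis by (smt (verit))
  qed
  then have "g (x + s *\<^sub>R u + t *\<^sub>R v) v = g' (x + s' *\<^sub>R v + t' *\<^sub>R u) u"
    using \<open>h > 0\<close> by simp
  moreover have "dist (g (x + s *\<^sub>R u + t *\<^sub>R v) v) (g x v) < e"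
    "dist (g' (x + s' *\<^sub>R v + t' *\<^sub>R u) u) (g' x u) < e"
    using d[OF near[OF st(1,2)]] d[OF near'[OF st'(1,2)]] by auto
  ultimately show False
    unfolding e_def dist_real_def by (smt (verit) field_sum_of_halves)
qed

text \<open>Pairing with an arbitrary fixed \<open>w\<close> reduces the claim to real-valued
  functions.\<close>

lemma second_derivative_symmetric:
  fixes f :: "'a::real_normed_vector \<Rightarrow> 'b::real_inner"
  assumes "open S" "x \<in> S" "Ck_on 2 S f"
  shows "frechet_derivative (\<lambda>y. frechet_derivative f (at y) u) (at x) v
       = frechet_derivative (\<lambda>y. frechet_derivative f (at y) v) (at x) u"
proof -
  let ?D = "\<lambda>y. frechet_derivative f (at y)"
  let ?H = "\<lambda>u y. frechet_derivative (\<lambda>y. ?D y u) (at y)"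
  have C: "Ck_on (Suc (Suc 0)) S f" using assms(3) by (simp add: numeral_2_eq_2)
  then have C1: "Ck_on (Suc 0) S (\<lambda>y. ?D y u)" for u by simp
  have cont: "continuous_on S (\<lambda>y. ?H u y v)" for u v using C1[of u] by simp
  have "?H u x v \<bullet> w = ?H v x u \<bullet> w" for w
  proof (rule second_derivative_symmetric_real[OF assms(1,2),
        where f = "\<lambda>y. f y \<bullet> w" and f' = "\<lambda>y e. ?D y e \<bullet> w"
        and g = "\<lambda>y e. ?H u y e \<bullet> w" and g' = "\<lambda>y e. ?H v y e \<bullet> w"])
    show "((\<lambda>y. f y \<bullet> w) has_derivative (\<lambda>e. ?D y e \<bullet> w)) (at y)" if "y \<in> S" for y
      by (intro has_derivative_inner_left Ck_on_Suc_has_derivative[OF C that])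
    show "((\<lambda>y. ?D y u \<bullet> w) has_derivative (\<lambda>e. ?H u y e \<bullet> w)) (at y)"
      "((\<lambda>y. ?D y v \<bullet> w) has_derivative (\<lambda>e. ?H v y e \<bullet> w)) (at y)" if "y \<in> S" for y
      by (intro has_derivative_inner_left Ck_on_Suc_has_derivative[OF C1 that])+
  qed (intro continuous_intros cont)+
  then have "\<forall>w. ?H u x v \<bullet> w = ?H v x u \<bullet> w"
    by blast
  then show ?thesis
    by (simp only: vector_eq_rdot)
qed

section \<open>Geodesics in charts\<close>

text \<open>The derivative sees only base points in \<open>V\<close>. Hence a metric known over the
  image of the chart may be replaced by an extension \<open>F\<close> that is differentiable in the
  ambient space.\<close>

lemma coord_metric_cong:
  assumes "open V" "x \<in> V" and "\<And>z y. z \<in> V \<Longrightarrow> G (\<psi> z) y = F (\<psi> z) y"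
    and "((\<lambda>z. coord_metric \<psi> F z w) has_derivative D) (at x)"
  shows "frechet_derivative (\<lambda>z. coord_metric \<psi> G z w) (at x) = D"
proof -
  have "((\<lambda>z. coord_metric \<psi> G z w) has_derivative D) (at x)"
    by (rule has_derivative_transform_within_open[OF assms(4,1,2)]) (simp add: coord_metric_def assms(3))
  then show ?thesis by (rule frechet_derivative_at[symmetric])
qed

text \<open>The Euler-Lagrange equations may be checked in the ambient space: \<eta> and \<xi> are
  the gradients of an extension \<open>F\<close> in position and velocity along \<gamma>, and the
  equation reads \<xi>' = \<eta>. In the chart, each side becomes \<eta> paired with the image of
  \<open>e\<close> plus \<xi> paired with a second derivative of \<psi> in the directions
  \<open>e\<close> and \<open>c'\<close>.\<close>

lemma is_geodesic_chart:
  fixes \<psi> :: "'b::euclidean_space \<Rightarrow> 'a::euclidean_space"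
  assumes "open V" "smooth_on V \<psi>" "a < b" "smooth_on {a<..<b} c" "c ` {a<..<b} \<subseteq> V"
    and \<gamma>: "\<And>t. t \<in> {a<..<b} \<Longrightarrow> \<psi> (c t) = \<gamma> t"
    and \<gamma>': "\<And>t. t \<in> {a<..<b} \<Longrightarrow> (\<gamma> has_vector_derivative \<gamma>' t) (at t)"
    and admissible: "\<And>t. t \<in> {a<..<b} \<Longrightarrow> (\<gamma> t, \<gamma>' t) \<in> A"
    and G: "\<And>x y. x \<in> V \<Longrightarrow> G (\<psi> x) y = F (\<psi> x) y"
    and F: "\<And>t. t \<in> {a<..<b} \<Longrightarrow>
      ((\<lambda>(x, y). F x y) has_derivative (\<lambda>(e, d). \<eta> t \<bullet> e + \<xi> t \<bullet> d)) (at (\<gamma> t, \<gamma>' t))"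
    and \<xi>: "\<And>t. t \<in> {a<..<b} \<Longrightarrow> (\<xi> has_vector_derivative \<eta> t) (at t)"
  shows "is_geodesic (coord_metric \<psi> G) (coord_domain V \<psi> A) c a b"
proof -
  let ?D = "\<lambda>x. frechet_derivative \<psi> (at x)"
  let ?H = "\<lambda>x v. frechet_derivative (\<lambda>z. ?D z v) (at x)"
  let ?w = "\<lambda>t. vector_derivative c (at t)"
  have C2: "Ck_on (Suc (Suc 0)) V \<psi>" using assms(2) by (simp only: smooth_on_def)
  then have C1: "Ck_on (Suc 0) V (\<lambda>x. ?D x v)" for v by simp
  have c': "(c has_vector_derivative ?w t) (at t)" if "t \<in> {a<..<b}" for t
  proof -
    have "Ck_on (Suc 0) {a<..<b} c" using assms(4) by (simp only: smooth_on_def)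
    then show ?thesis using that by (auto simp flip: vector_derivative_works)
  qed
  have D: "(\<psi> has_derivative ?D (c t)) (at (c t))" if "t \<in> {a<..<b}" for t
    using Ck_on_Suc_has_derivative[OF C2] that assms(5) by blast
  have H: "((\<lambda>x. ?D x v) has_derivative ?H (c t) v) (at (c t))" if "t \<in> {a<..<b}" for t v
    using Ck_on_Suc_has_derivative[OF C1] that assms(5) by blast
  have push: "?D (c t) (?w t) = \<gamma>' t" if t: "t \<in> {a<..<b}" for t
  proof (rule vector_derivative_unique_at)
    show "(\<gamma> has_vector_derivative \<gamma>' t) (at t)" by (rule \<gamma>'[OF t])
    have "((\<lambda>s. \<psi> (c s)) has_vector_derivative ?D (c t) (?w t)) (at t)"
      using has_derivative_compose[OF c'[OF t, unfolded has_vector_derivative_def] D[OF t]]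
        linear_cmul[OF has_derivative_linear[OF D[OF t]]]
      by (simp add: has_vector_derivative_def)
    then show "(\<gamma> has_vector_derivative ?D (c t) (?w t)) (at t)"
      by (rule has_vector_derivative_transform_within_open[OF _ _ t]) (auto simp: \<gamma>)
  qed
  have "(c t, ?w t) \<in> coord_domain V \<psi> A" if "t \<in> {a<..<b}" for t
    using that assms(5) admissible push \<gamma> by (auto simp: coord_domain_def)
  moreover have "((\<lambda>s. frechet_derivative (coord_metric \<psi> G (c s)) (at (?w s)) e)
      has_real_derivative frechet_derivative (\<lambda>x. coord_metric \<psi> G x (?w t)) (at (c t)) e) (at t)"
    if t: "t \<in> {a<..<b}" for t e
  proof -
    \<comment> \<open>Over a fixed base point the metric is \<open>F\<close> composed with the
      linear map \<open>?D (c s)\<close>, so its differential is \<xi> pulled back to the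
      chart.\<close>
    have fibre: "frechet_derivative (coord_metric \<psi> G (c s)) (at (?w s)) e = \<xi> s \<bullet> ?D (c s) e"
      if s: "s \<in> {a<..<b}" for s
    proof -
      have lin: "(?D (c s) has_derivative ?D (c s)) (at (?w s))"
        using has_derivative_bounded_linear[OF D[OF s]] bounded_linear_imp_has_derivative by blast
      have "((\<lambda>y. (\<gamma> s, ?D (c s) y)) has_derivative (\<lambda>y. (0, ?D (c s) y))) (at (?w s))"
        by (intro has_derivative_Pair has_derivative_const lin)
      from has_derivative_compose[OF this F[OF s, folded push[OF s]]]
      have "((\<lambda>y. F (\<gamma> s) (?D (c s) y)) has_derivative (\<lambda>y. \<xi> s \<bullet> ?D (c s) y)) (at (?w s))"
        by simp
      moreover have "coord_metric \<psi> G (c s) = (\<lambda>y. F (\<gamma> s) (?D (c s) y))"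
        using G[OF subsetD[OF assms(5) imageI[OF s]]] by (simp add: coord_metric_def \<gamma>[OF s] fun_eq_iff)
      ultimately show ?thesis using frechet_derivative_at by metis
    qed
    have "((\<lambda>s. ?D (c s) e) has_vector_derivative ?H (c t) e (?w t)) (at t)"
      using has_derivative_compose[OF c'[OF t, unfolded has_vector_derivative_def] H[OF t, of e]]
        linear_cmul[OF has_derivative_linear[OF H[OF t, of e]]]
      by (simp add: has_vector_derivative_def)
    then have "((\<lambda>s. \<xi> s \<bullet> ?D (c s) e) has_real_derivative
        \<xi> t \<bullet> ?H (c t) e (?w t) + \<eta> t \<bullet> ?D (c t) e) (at t)"
      using \<xi>[OF t] unfolding has_real_derivative_iff_has_vector_derivative
      by (auto intro!: bounded_bilinear.has_vector_derivative[OF bounded_bilinear_inner])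
    then have "((\<lambda>s. frechet_derivative (coord_metric \<psi> G (c s)) (at (?w s)) e) has_real_derivative
        \<xi> t \<bullet> ?H (c t) e (?w t) + \<eta> t \<bullet> ?D (c t) e) (at t)"
      by (rule has_field_derivative_transform_within_open[OF _ _ t]) (auto simp: fibre)
    \<comment> \<open>The two sides differ only in the order of differentiation of \<psi>.\<close>
    moreover have "?H (c t) e (?w t) = ?H (c t) (?w t) e"
      by (rule second_derivative_symmetric[OF assms(1)])
        (use C2 t assms(5) in \<open>auto simp: numeral_2_eq_2\<close>)
    \<comment> \<open>Moving the base point also moves the image of the fixed coordinate vector
      \<open>?w t\<close>, which contributes the second derivative of \<psi>.\<close>
    moreover have "frechet_derivative (\<lambda>x. coord_metric \<psi> G x (?w t)) (at (c t))
        = (\<lambda>e. \<eta> t \<bullet> ?D (c t) e + \<xi> t \<bullet> ?H (c t) (?w t) e)"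
    proof (rule coord_metric_cong[where F = F and G = G and V = V])
      have "((\<lambda>x. (\<psi> x, ?D x (?w t))) has_derivative (\<lambda>e. (?D (c t) e, ?H (c t) (?w t) e))) (at (c t))"
        by (intro has_derivative_Pair D H t)
      from has_derivative_compose[OF this F[OF t, folded push[OF t] \<gamma>[OF t]]]
      show "((\<lambda>x. coord_metric \<psi> F x (?w t)) has_derivative
          (\<lambda>e. \<eta> t \<bullet> ?D (c t) e + \<xi> t \<bullet> ?H (c t) (?w t) e)) (at (c t))"
        by (simp add: coord_metric_def)
    qed (use t assms(1,5) G in auto)
    ultimately show ?thesis by (simp add: add.commute)
  qed
  ultimately show ?thesis
    using assms(3,4) by (simp add: is_geodesic_def)
qed

text \<open>A curve on a line is an affine function of the scalar coordinate
  \<open>c t \<bullet> u\<close>. Rolle's theorem gives a critical point of this coordinate, which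
  is then critical for the curve.\<close>

lemma collinear_closed_curve_critical_point:
  fixes c :: "real \<Rightarrow> 'b::euclidean_space"
  assumes col: "collinear (c ` S)" and "open S" "{s..s'} \<subseteq> S" "s < s'" "c s = c s'"
    and c': "\<And>t. t \<in> S \<Longrightarrow> (c has_vector_derivative c' t) (at t)"
  obtains t where "t \<in> {s<..<s'}" "c' t = 0"
proof -
  from col obtain u where u: "\<And>x y. x \<in> c ` S \<Longrightarrow> y \<in> c ` S \<Longrightarrow> \<exists>k. x - y = k *\<^sub>R u"
    unfolding collinear_def by blast
  have s: "s \<in> S" using assms by auto
  \<comment> \<open>If \<open>u = 0\<close> the curve is constant, and the formula survives because
    the inverse of 0 is 0.\<close>
  have c_eq: "c t = c s + (c t \<bullet> u - c s \<bullet> u) *\<^sub>R (u /\<^sub>R (u \<bullet> u))" if t: "t \<in> S" for t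
  proof -
    obtain k where "c t - c s = k *\<^sub>R u" using u t s by blast
    then have "c t = c s + k *\<^sub>R u" by (simp add: algebra_simps)
    then show ?thesis by (cases "u = 0") (simp_all add: inner_add_left)
  qed
  have f': "((\<lambda>t. c t \<bullet> u) has_derivative (\<lambda>h. h *\<^sub>R c' t \<bullet> u)) (at t)" if "t \<in> S" for t
    using c'[OF that] unfolding has_vector_derivative_def by (rule has_derivative_inner_left)
  have "continuous_on {s..s'} (\<lambda>t. c t \<bullet> u)"
    by (rule has_derivative_continuous_on[OF has_derivative_at_withinI[OF f']]) (use assms in auto)
  from Rolle_deriv[OF \<open>s < s'\<close> _ this, of "\<lambda>t h. h *\<^sub>R c' t \<bullet> u"] f' assms(3,5)
  obtain t where t: "s < t" "t < s'" "(\<lambda>h. h *\<^sub>R c' t \<bullet> u) = (\<lambda>h. 0)"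
    by (smt (verit) atLeastAtMost_iff subset_iff)
  then have "t \<in> S" using assms(3) by auto
  have "((\<lambda>t. c s + (c t \<bullet> u - c s \<bullet> u) *\<^sub>R (u /\<^sub>R (u \<bullet> u))) has_derivative
      (\<lambda>h. 0 + (0 - 0) *\<^sub>R (u /\<^sub>R (u \<bullet> u)))) (at t)"
    by (intro has_derivative_add has_derivative_scaleR_left has_derivative_diff has_derivative_const
        f'[OF \<open>t \<in> S\<close>, unfolded t(3)])
  then have "((\<lambda>t. c s + (c t \<bullet> u - c s \<bullet> u) *\<^sub>R (u /\<^sub>R (u \<bullet> u))) has_derivative (\<lambda>h. 0)) (at t)"
    by simp
  then have "(c has_derivative (\<lambda>h. 0)) (at t)"
    by (rule has_derivative_transform_within_open[OF _ \<open>open S\<close> \<open>t \<in> S\<close>]) (use c_eq in auto)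
  then have "(c has_vector_derivative 0) (at t)"
    by (simp add: has_vector_derivative_def)
  then have "c' t = 0"
    using c'[OF \<open>t \<in> S\<close>] vector_derivative_unique_at by blast
  with t that show thesis by auto
qed

section \<open>Unit Killing fields of the sphere\<close>

text \<open>Let \<gamma> be the great circle from \<open>x\<close> to \<open>y\<close>. The
  derivative of \<open>W \<gamma> \<bullet> \<gamma>'\<close> is the Killing term in the direction
  \<gamma>', which vanishes, plus \<open>W \<gamma> \<bullet> \<gamma>''\<close>, which vanishes
  since \<gamma>'' = -\<gamma> is normal to the sphere. With the constant value \<open>k\<close> and
  the angle \<theta> between \<open>x\<close> and \<open>y\<close>, both sides equal
  \<open>sin \<theta> * k\<close>.\<close>

lemma killing_field_skew:
  fixes W :: "'a::euclidean_space \<Rightarrow> 'a"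
  assumes "killing_field (round_metric K) W" "K \<noteq> 0" "norm x = 1" "norm y = 1"
  shows "W x \<bullet> y = - (x \<bullet> W y)"
proof -
  have tangent: "W z \<bullet> z = 0" if "norm z = 1" for z
    using assms(1) that by (auto simp: killing_field_def sphere_vector_field_def tangent_sphere_def)
  define \<alpha> where "\<alpha> = y - (x \<bullet> y) *\<^sub>R x"
  have x\<alpha>: "x \<bullet> \<alpha> = 0"
    using assms(3) by (simp add: \<alpha>_def inner_diff_right norm_eq_1)
  show ?thesis
  proof (cases "\<alpha> = 0")
    \<comment> \<open>Here \<open>y\<close> is \<open>x\<close> or \<open>- x\<close>, and both
      sides vanish by tangency.\<close>
    case True
    then have y: "y = (x \<bullet> y) *\<^sub>R x" by (simp add: \<alpha>_def)
    then have "\<bar>x \<bullet> y\<bar> = 1" using assms(3,4) by (metis mult.right_neutral norm_scaleR)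
    then have "x = (x \<bullet> y) *\<^sub>R y"
      by (subst y) (auto simp: abs_if split: if_splits simp flip: scaleR_scaleR)
    then have "x \<bullet> W y = 0"
      using tangent[OF assms(4)] by (metis inner_commute inner_scaleR_left mult_zero_right)
    moreover have "W x \<bullet> y = 0"
      using tangent[OF assms(3)] y by (metis inner_scaleR_right mult_zero_right)
    ultimately show ?thesis by simp
  next
    case False
    define u where "u = sgn \<alpha>"
    have u: "norm u = 1" "x \<bullet> u = 0"
      using False x\<alpha> by (simp_all add: u_def norm_sgn sgn_div_norm)
    define r where "r = norm \<alpha>"
    have y: "y = (x \<bullet> y) *\<^sub>R x + r *\<^sub>R u"
      using False by (simp add: u_def r_def sgn_div_norm \<alpha>_def)
    have uu: "u \<bullet> u = 1" "x \<bullet> x = 1" using u assms(3) by (simp_all add: norm_eq_1)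
    have "1 = y \<bullet> y" using assms(4) by (simp add: norm_eq_1)
    also have "\<dots> = (x \<bullet> y)\<^sup>2 + r\<^sup>2"
      by (subst (1 2) y) (simp add: inner_add_left inner_add_right uu u inner_commute[of u x] power2_eq_square)
    \<comment> \<open>The coordinates of the unit vector \<open>y\<close> in the orthonormal frame
      \<open>x\<close>, \<open>u\<close> are the cosine and sine of an angle.\<close>
    finally obtain \<theta> where \<theta>: "x \<bullet> y = cos \<theta>" "r = sin \<theta>"
      using sincos_total_2pi[of "x \<bullet> y" r] by metis
    define \<gamma> where "\<gamma> t = cos t *\<^sub>R x + sin t *\<^sub>R u" for t
    define \<gamma>' where "\<gamma>' t = cos t *\<^sub>R u - sin t *\<^sub>R x" for t
    have \<gamma>\<gamma>: "\<gamma> t \<bullet> \<gamma> t = 1" "\<gamma> t \<bullet> \<gamma>' t = 0" for t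
      by (simp_all add: \<gamma>_def \<gamma>'_def inner_add_left inner_add_right inner_diff_right uu u
          inner_commute[of u x] flip: power2_eq_square)
    then have n\<gamma>: "norm (\<gamma> t) = 1" for t by (simp add: norm_eq_1)
    then have sgn\<gamma>: "sgn (\<gamma> t) = \<gamma> t" for t by (simp add: sgn_div_norm)
    let ?D = "\<lambda>t. frechet_derivative (\<lambda>z. W (sgn z)) (at (\<gamma> t))"
    have smooth: "smooth_on_sphere (sphere 0 1) W"
      using assms(1) by (simp add: killing_field_def sphere_vector_field_def)
    have "Ck_on (Suc 0) {z. sgn z \<in> sphere 0 1} (\<lambda>z. W (sgn z))"
      using smooth by (simp only: smooth_on_sphere_def smooth_on_def)
    from Ck_on_Suc_has_derivative[OF this]
    have D: "((\<lambda>z. W (sgn z)) has_derivative ?D t) (at (\<gamma> t))" for t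
      by (simp add: sgn\<gamma> n\<gamma>)
    \<comment> \<open>Put \<gamma>' in both slots of the Killing equation: the metric is constant in
      its base point, and the two remaining terms coincide.\<close>
    have killing: "?D t (\<gamma>' t) \<bullet> \<gamma>' t = 0" for t
    proof -
      have "\<gamma> t \<in> sphere 0 1" "\<gamma>' t \<in> tangent_sphere (\<gamma> t)"
        using n\<gamma> \<gamma>\<gamma>(2)[of t] by (simp_all add: tangent_sphere_def inner_commute)
      then have "lie_derivative_metric W (round_metric K) (\<gamma> t) (\<gamma>' t) (\<gamma>' t) = 0"
        using assms(1) by (simp add: killing_field_def)
      then show ?thesis
        using assms(2) by (simp add: lie_derivative_metric_def round_metric_def inner_commute)
    qed
    have \<gamma>_deriv: "(\<gamma> has_derivative (\<lambda>h. h *\<^sub>R \<gamma>' t)) (at t)" for t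
      unfolding \<gamma>_def \<gamma>'_def by (auto intro!: derivative_eq_intros simp: algebra_simps)
    have \<gamma>'_deriv: "(\<gamma>' has_derivative (\<lambda>h. h *\<^sub>R - \<gamma> t)) (at t)" for t
      unfolding \<gamma>_def \<gamma>'_def by (auto intro!: derivative_eq_intros simp: algebra_simps)
    have "((\<lambda>t. W (sgn (\<gamma> t)) \<bullet> \<gamma>' t) has_derivative (\<lambda>h. 0)) (at t)" for t
    proof -
      have "((\<lambda>t. W (sgn (\<gamma> t)) \<bullet> \<gamma>' t) has_derivative
          (\<lambda>h. W (sgn (\<gamma> t)) \<bullet> (h *\<^sub>R - \<gamma> t) + ?D t (h *\<^sub>R \<gamma>' t) \<bullet> \<gamma>' t)) (at t)"
        by (intro has_derivative_inner has_derivative_compose[OF \<gamma>_deriv D] \<gamma>'_deriv)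
      moreover have "?D t (h *\<^sub>R \<gamma>' t) = h *\<^sub>R ?D t (\<gamma>' t)" for h
        using linear_cmul[OF has_derivative_linear[OF D]] .
      ultimately show ?thesis
        by (simp add: killing sgn\<gamma> tangent[OF n\<gamma>])
    qed
    then have "((\<lambda>t. W (sgn (\<gamma> t)) \<bullet> \<gamma>' t) has_derivative (\<lambda>h. 0)) (at t within UNIV)" for t
      by simp
    from has_derivative_zero_constant[OF convex_UNIV this]
    obtain k where "W (sgn (\<gamma> t)) \<bullet> \<gamma>' t = k" for t
      by auto
    then have k: "W (\<gamma> t) \<bullet> \<gamma>' t = k" for t by (simp add: sgn\<gamma>)
    have "\<gamma> 0 = x" "\<gamma>' 0 = u" by (simp_all add: \<gamma>_def \<gamma>'_def)
    then have Wx: "W x \<bullet> u = k" using k[of 0] by simp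
    have y\<gamma>: "\<gamma> \<theta> = y" using y \<theta> by (simp add: \<gamma>_def)
    \<comment> \<open>Rotating the frame at \<open>y\<close> back by \<theta> expresses
      \<open>x\<close> in it, so the constant \<open>k\<close> also determines
      \<open>W y \<bullet> x\<close>.\<close>
    have "x = cos \<theta> *\<^sub>R \<gamma> \<theta> - sin \<theta> *\<^sub>R \<gamma>' \<theta>"
      by (simp add: \<gamma>_def \<gamma>'_def algebra_simps flip: scaleR_add_left power2_eq_square)
    then have "W y \<bullet> x = - sin \<theta> * k"
      using k[of \<theta>] tangent[OF assms(4)] unfolding y\<gamma> by (simp add: inner_diff_right)
    moreover have "W x \<bullet> y = sin \<theta> * k"
      by (subst y) (simp add: inner_add_right Wx \<theta> tangent[OF assms(3)])
    ultimately show ?thesis by (simp add: inner_commute)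
  qed
qed

section \<open>Linear extension of a unit Killing field\<close>

lemma inner_right_ext: "(\<And>z. x \<bullet> z = y \<bullet> z) \<Longrightarrow> x = y"
  by (rule vector_eq_rdot[THEN iffD1]) blast

text \<open>Skewness moves \<open>A\<close> to the other factor, where only the linearity of the
  inner product in its first argument is needed.\<close>

lemma linear_if_skew:
  fixes A :: "'a::real_inner \<Rightarrow> 'a"
  assumes "\<And>x y. A x \<bullet> y = - (x \<bullet> A y)"
  shows "linear A"
proof (rule linearI)
  fix x y :: 'a and r :: real
  have "A (x + y) \<bullet> z = (A x + A y) \<bullet> z" for z
    by (simp add: inner_add_left assms)
  then show "A (x + y) = A x + A y" by (rule inner_right_ext)
  have "A (r *\<^sub>R x) \<bullet> z = (r *\<^sub>R A x) \<bullet> z" for z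
    by (simp add: assms)
  then show "A (r *\<^sub>R x) = r *\<^sub>R A x" by (rule inner_right_ext)
qed

text \<open>The rescaled homogeneous extension of \<open>W\<close> inherits skewness and is
  therefore linear; unit length makes it an isometry. A skew isometry squares to minus the
  identity.\<close>

lemma unit_killing_field_complex_structure:
  fixes W :: "'a::euclidean_space \<Rightarrow> 'a"
  assumes "killing_field (round_metric K) W" "0 < K"
    and unit: "\<forall>x\<in>sphere 0 1. round_metric K x (W x) (W x) = 1"
  obtains J where "linear J" "\<And>x y. J x \<bullet> y = - (x \<bullet> J y)" "\<And>x. J (J x) = - x"
    "\<And>x. norm x = 1 \<Longrightarrow> W x = sqrt K *\<^sub>R J x"
proof -
  \<comment> \<open>Unit length for \<open>round_metric K\<close> means Euclidean length
    \<open>sqrt K\<close>, hence the denominator.\<close>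
  define J where "J x = (norm x / sqrt K) *\<^sub>R W (sgn x)" for x
  have skew: "J x \<bullet> y = - (x \<bullet> J y)" for x y
  proof (cases "x = 0 \<or> y = 0")
    case False
    then have "W (sgn x) \<bullet> sgn y = - (sgn x \<bullet> W (sgn y))"
      using assms(1,2) by (intro killing_field_skew) (auto simp: norm_sgn)
    then have "W (sgn x) \<bullet> y / norm y = - (x \<bullet> W (sgn y)) / norm x"
      by (simp add: sgn_div_norm divide_inverse mult.commute)
    then have "norm x * (W (sgn x) \<bullet> y) = - (norm y * (x \<bullet> W (sgn y)))"
      using False by (simp add: field_simps)
    then show ?thesis
      by (simp add: J_def)
  qed (auto simp: J_def)
  then have lin: "linear J" by (rule linear_if_skew)
  have isometry: "J x \<bullet> J x = x \<bullet> x" for x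
  proof (cases "x = 0")
    case False
    then have "W (sgn x) \<bullet> W (sgn x) = K"
      using bspec[OF unit, of "sgn x"] \<open>0 < K\<close> by (simp add: round_metric_def norm_sgn)
    moreover have "J x \<bullet> J x = (norm x * norm x) * (W (sgn x) \<bullet> W (sgn x)) / K"
      using \<open>0 < K\<close> by (simp add: J_def)
    ultimately show ?thesis
      using \<open>0 < K\<close> by (simp add: dot_square_norm power2_eq_square)
  qed (simp add: J_def)
  \<comment> \<open>Polarisation: expand the isometry property at \<open>x + y\<close>.\<close>
  have polar: "J x \<bullet> J y = x \<bullet> y" for x y
    using isometry[of "x + y"] isometry[of x] isometry[of y]
    by (simp add: linear_add[OF lin] inner_add_left inner_add_right inner_commute)
  have "J (J x) \<bullet> y = (- x) \<bullet> y" for x y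
    by (simp add: skew[of "J x"] polar)
  then have "J (J x) = - x" for x
    by (rule inner_right_ext)
  moreover have "W x = sqrt K *\<^sub>R J x" if "norm x = 1" for x
    using that \<open>0 < K\<close> by (simp add: J_def sgn_div_norm)
  ultimately show thesis
    using that lin skew by blast
qed

section \<open>Small closed geodesics\<close>

text \<open>
  A complex line meets the unit sphere in such a circle, \<open>a\<close> being its point closest to the origin.
\<close>

definition complex_circle :: "('a \<Rightarrow> 'a) \<Rightarrow> 'a \<Rightarrow> 'a \<Rightarrow> real \<Rightarrow> 'a::euclidean_space" where
  "complex_circle J a b t = a + cos t *\<^sub>R b + sin t *\<^sub>R J b"

text \<open>The conditions \<open>perp\<close> make \<open>a\<close> orthogonal to the complex line
  of \<open>b\<close>, so the circle has centre \<open>a\<close> and radius \<open>norm b\<close>;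
  \<open>unit\<close> then puts it on the unit sphere.\<close>

locale complex_line_circle =
  fixes J :: "'a::euclidean_space \<Rightarrow> 'a" and a b :: 'a
  assumes lin: "linear J" and skew: "J x \<bullet> y = - (x \<bullet> J y)" and JJ: "J (J x) = - x"
    and perp: "a \<bullet> b = 0" "a \<bullet> J b = 0" and b: "b \<noteq> 0" and unit: "a \<bullet> a + b \<bullet> b = 1"
begin

abbreviation "\<gamma> \<equiv> complex_circle J a b"
text \<open>As \<open>J (J b) = - b\<close>, the velocity runs through a circle of the same form,
  centred at the origin.\<close>

abbreviation "\<gamma>' \<equiv> complex_circle J 0 (J b)"

lemma J_combination: "J (x + r *\<^sub>R y + s *\<^sub>R z) = J x + r *\<^sub>R J y + s *\<^sub>R J z"
  by (simp add: linear_add[OF lin] linear_cmul[OF lin])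

lemma J_self: "x \<bullet> J x = 0"
  using skew[of x x] by (simp add: inner_commute)

lemma J_isometry: "J x \<bullet> J x = x \<bullet> x"
  using skew[of x "J x"] by (simp add: JJ)

lemma circle_basis_inner:
  "b \<bullet> a = 0" "J b \<bullet> a = 0" "b \<bullet> J b = 0" "J b \<bullet> b = 0" "J b \<bullet> J b = b \<bullet> b"
  "b \<bullet> J a = 0" "J a \<bullet> b = 0" "J b \<bullet> J a = 0" "J a \<bullet> J b = 0"
  using perp J_self[of b] J_isometry[of b] skew[of b a] skew[of "J b" a] skew[of a b] skew[of a "J b"]
  by (auto simp: inner_commute JJ)

text \<open>The right side is the acceleration: along the circle, applying \<open>J\<close> to the
  velocity differentiates it.\<close>

lemma J_velocity: "J (\<gamma>' t) = - (cos t *\<^sub>R b + sin t *\<^sub>R J b)"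
  by (simp only: complex_circle_def J_combination JJ) (simp add: linear_0[OF lin] linear_neg[OF lin])

lemma J_circle: "J (\<gamma> t) = J a + cos t *\<^sub>R J b - sin t *\<^sub>R b"
  by (simp only: complex_circle_def J_combination JJ) simp

text \<open>Besides placing the circle on the sphere, this shows that \<open>y \<bullet> y\<close>
  and \<open>y \<bullet> J x\<close> keep the same constant value along it, so numerator and
  denominator of the Kropina metric are constant there.\<close>

lemma circle_inner:
  "\<gamma> t \<bullet> \<gamma> t = 1" "\<gamma>' t \<bullet> \<gamma> t = 0" "\<gamma>' t \<bullet> \<gamma>' t = b \<bullet> b" "\<gamma>' t \<bullet> J (\<gamma> t) = b \<bullet> b"
proof -
  have sq: "x * cos t * cos t + x * sin t * sin t = x" for x
    by (metis distrib_left mult.assoc mult.right_neutral power2_eq_square sin_cos_squared_add2)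
  show "\<gamma> t \<bullet> \<gamma> t = 1" "\<gamma>' t \<bullet> \<gamma> t = 0" "\<gamma>' t \<bullet> \<gamma>' t = b \<bullet> b" "\<gamma>' t \<bullet> J (\<gamma> t) = b \<bullet> b"
    unfolding J_circle using sq[of "b \<bullet> b"] unit
    by (simp_all add: complex_circle_def JJ inner_diff_left inner_diff_right inner_add_left inner_add_right
        circle_basis_inner perp algebra_simps)
qed

lemma norm_circle: "norm (\<gamma> t) = 1"
  by (simp add: norm_eq_1 circle_inner)

lemma circle_has_vector_derivative: "(\<gamma> has_vector_derivative \<gamma>' t) (at t)"
  unfolding complex_circle_def has_vector_derivative_def
  by (auto intro!: derivative_eq_intros simp: JJ fun_eq_iff algebra_simps)

lemma velocity_has_vector_derivative: "(\<gamma>' has_vector_derivative J (\<gamma>' t)) (at t)"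
  unfolding J_velocity unfolding complex_circle_def has_vector_derivative_def
  by (auto intro!: derivative_eq_intros simp: JJ fun_eq_iff algebra_simps)

lemma J_circle_has_vector_derivative: "((\<lambda>t. J (\<gamma> t)) has_vector_derivative J (\<gamma>' t)) (at t)"
  by (rule bounded_linear.has_vector_derivative[OF lin[unfolded linear_conv_bounded_linear]
        circle_has_vector_derivative])

text \<open>The velocity gradient of \<open>(y \<bullet> y) / (2 * (y \<bullet> (\<omega> *\<^sub>R
  J x)))\<close> at position \<gamma> and velocity \<gamma>', simplified by
  \<open>circle_inner\<close>.\<close>

definition momentum :: "real \<Rightarrow> real \<Rightarrow> 'a" where
  "momentum \<omega> t = (1 / (\<omega> * (b \<bullet> b))) *\<^sub>R (\<gamma>' t - (1/2) *\<^sub>R J (\<gamma> t))"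

text \<open>The position gradient of the same function, with \<open>J\<close> moved onto the
  velocity by skewness.\<close>

definition force :: "real \<Rightarrow> real \<Rightarrow> 'a" where
  "force \<omega> t = (1 / (\<omega> * (b \<bullet> b))) *\<^sub>R ((1/2) *\<^sub>R J (\<gamma>' t))"

text \<open>This is the Euler-Lagrange equation. Both \<gamma>' and \<open>J \<gamma>\<close> have
  derivative \<open>J \<gamma>'\<close>, so subtracting half of the latter leaves half of
  it.\<close>

lemma momentum_has_vector_derivative: "(momentum \<omega> has_vector_derivative force \<omega> t) (at t)"
proof -
  have "(momentum \<omega> has_vector_derivative
      (1 / (\<omega> * (b \<bullet> b))) *\<^sub>R (J (\<gamma>' t) - (1/2) *\<^sub>R J (\<gamma>' t))) (at t)"
    unfolding momentum_def
    by (intro derivative_intros bounded_linear.has_vector_derivative[OF bounded_linear_scaleR_right]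
        velocity_has_vector_derivative J_circle_has_vector_derivative)
  moreover have "J (\<gamma>' t) - (1/2) *\<^sub>R J (\<gamma>' t) = (1/2) *\<^sub>R J (\<gamma>' t)"
    using scaleR_left_diff_distrib[of 1 "1/2" "J (\<gamma>' t)"] by simp
  ultimately show ?thesis by (simp add: force_def)
qed

lemma kropina_has_derivative:
  assumes "\<omega> \<noteq> 0"
  shows "((\<lambda>(x, y). (y \<bullet> y) / (2 * (y \<bullet> (\<omega> *\<^sub>R J x)))) has_derivative
    (\<lambda>(e, d). force \<omega> t \<bullet> e + momentum \<omega> t \<bullet> d)) (at (\<gamma> t, \<gamma>' t))"
proof -
  let ?z = "(\<gamma> t, \<gamma>' t)" and ?r = "b \<bullet> b"
  have J: "((\<lambda>z. J (fst z)) has_derivative (\<lambda>h. J (fst h))) (at ?z)"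
    by (rule has_derivative_compose[OF has_derivative_fst[OF has_derivative_ident]
        bounded_linear_imp_has_derivative[OF lin[unfolded linear_conv_bounded_linear]]])
  have r: "?r \<noteq> 0" using b by simp
  have inner_flip: "J (\<gamma> t) \<bullet> \<gamma>' t = ?r"
    by (subst inner_commute) (rule circle_inner(4))
  have "((\<lambda>z. (snd z \<bullet> snd z) / (2 * (snd z \<bullet> (\<omega> *\<^sub>R J (fst z))))) has_derivative
      (\<lambda>h. (2 * (\<gamma>' t \<bullet> snd h) * (2 * (\<omega> * ?r))
        - ?r * (2 * (\<omega> * (\<gamma>' t \<bullet> J (fst h) + snd h \<bullet> J (\<gamma> t)))))
        / ((2 * (\<omega> * ?r)) * (2 * (\<omega> * ?r))))) (at ?z)"
    by (rule derivative_eq_intros J refl)+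
      (use assms r in \<open>simp_all add: circle_inner inner_flip fun_eq_iff inner_commute field_simps\<close>)
  moreover have "(2 * (\<gamma>' t \<bullet> d) * (2 * (\<omega> * ?r))
        - ?r * (2 * (\<omega> * (\<gamma>' t \<bullet> J e + d \<bullet> J (\<gamma> t))))) / ((2 * (\<omega> * ?r)) * (2 * (\<omega> * ?r)))
      = force \<omega> t \<bullet> e + momentum \<omega> t \<bullet> d" for e d
    using assms r skew[of "\<gamma>' t" e]
    by (simp add: force_def momentum_def inner_diff_left inner_commute[of d] field_simps)
  ultimately show ?thesis
    by (simp add: case_prod_beta')
qed

end

text \<open>The ambient extension of the metric replaces \<open>W\<close> by the linear field
  \<open>\<omega> *\<^sub>R J x\<close>; the factor \<open>1 / K\<close> cancels in the quotient.
  The map \<open>sgn\<close> is the identity on the circle and is inserted because smoothness of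
  \<phi> is stated for its radial extension.\<close>

lemma (in complex_line_circle) chart_circle_is_geodesic:
  fixes W :: "'a \<Rightarrow> 'a" and \<psi> :: "'b::euclidean_space \<Rightarrow> 'a"
  assumes chart: "sphere_chart U V \<phi> \<psi>" and "0 < K" "0 < \<omega>"
    and W: "\<And>x. norm x = 1 \<Longrightarrow> W x = \<omega> *\<^sub>R J x"
    and sub: "range \<gamma> \<subseteq> U" and "s < s'"
  shows "is_geodesic (coord_metric \<psi> (kropina_metric (round_metric K) W))
      (coord_domain V \<psi> (kropina_domain (round_metric K) W)) (\<lambda>t. \<phi> (sgn (\<gamma> t))) s s'"
proof (rule is_geodesic_chart[where \<gamma> = \<gamma> and \<gamma>' = \<gamma>'
      and F = "\<lambda>x y. (y \<bullet> y) / (2 * (y \<bullet> (\<omega> *\<^sub>R J x)))"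
      and \<xi> = "momentum \<omega>" and \<eta> = "force \<omega>"])
  have hom: "homeomorphism U V \<phi> \<psi>" and U: "openin (top_of_set (sphere 0 1)) U"
    using chart by (auto simp: sphere_chart_def)
  have sgn_circle: "sgn (\<gamma> t) = \<gamma> t" for t
    by (simp add: sgn_div_norm norm_circle)
  show "open V" "smooth_on V \<psi>"
    using chart by (auto simp: sphere_chart_def)
  show "s < s'" by fact
  show "(\<lambda>t. \<phi> (sgn (\<gamma> t))) ` {s<..<s'} \<subseteq> V"
    using hom sub by (auto simp: homeomorphism_def sgn_circle)
  show "\<psi> (\<phi> (sgn (\<gamma> t))) = \<gamma> t" for t
    using hom sub by (auto simp: homeomorphism_def sgn_circle)
  show "smooth_on {s<..<s'} (\<lambda>t. \<phi> (sgn (\<gamma> t)))"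
    unfolding smooth_on_def
  proof
    fix k
    show "Ck_on k {s<..<s'} (\<lambda>t. \<phi> (sgn (\<gamma> t)))"
    proof (rule Ck_on_compose[where f = "\<lambda>x. \<phi> (sgn x)" and S = "{x. sgn x \<in> U}"])
      show "\<gamma> ` {s<..<s'} \<subseteq> {x. sgn x \<in> U}"
        using sub by (auto simp: sgn_circle)
      show "Ck_on k {s<..<s'} \<gamma>"
        using smooth_on_ellipse[of "{s<..<s'}" a b "J b"]
        by (simp add: smooth_on_def complex_circle_def[abs_def])
      show "Ck_on k {x. sgn x \<in> U} (\<lambda>x. \<phi> (sgn x))"
        using chart by (simp add: sphere_chart_def smooth_on_sphere_def smooth_on_def)
    qed simp
  qed
  show "(\<gamma> t, \<gamma>' t) \<in> kropina_domain (round_metric K) W" for t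
    using b \<open>0 < K\<close> \<open>0 < \<omega>\<close>
    by (simp add: kropina_domain_def tangent_sphere_def round_metric_def norm_circle circle_inner W)
  show "kropina_metric (round_metric K) W (\<psi> x) y = (y \<bullet> y) / (2 * (y \<bullet> (\<omega> *\<^sub>R J (\<psi> x))))"
    if "x \<in> V" for x y
  proof -
    have "\<psi> x \<in> sphere 0 1"
      using hom U that openin_subset[OF U] by (auto simp: homeomorphism_def)
    then show ?thesis
      using \<open>0 < K\<close> by (simp add: kropina_metric_def round_metric_def W)
  qed
  show "(\<gamma> has_vector_derivative \<gamma>' t) (at t)" for t
    by (rule circle_has_vector_derivative)
  show "(momentum \<omega> has_vector_derivative force \<omega> t) (at t)" for t
    by (rule momentum_has_vector_derivative)
  show "((\<lambda>(x, y). (y \<bullet> y) / (2 * (y \<bullet> (\<omega> *\<^sub>R J x)))) has_derivative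
      (\<lambda>(e, d). force \<omega> t \<bullet> e + momentum \<omega> t \<bullet> d)) (at (\<gamma> t, \<gamma>' t))" for t
    using \<open>0 < \<omega>\<close> by (intro kropina_has_derivative) simp
qed

text \<open>Take centre \<open>cos \<tau> *\<^sub>R p\<close> and radius \<open>sin \<tau>\<close>,
  in the complex line direction of a unit vector \<open>w\<close> orthogonal to \<open>p\<close> and
  \<open>J p\<close>. Such a \<open>w\<close> exists because the real dimension exceeds 2, and the
  circle shrinks to \<open>p\<close> as \<tau> tends to 0.\<close>

lemma small_complex_line_circle:
  fixes J :: "'a::euclidean_space \<Rightarrow> 'a"
  assumes "linear J" "\<And>x y. J x \<bullet> y = - (x \<bullet> J y)" "\<And>x. J (J x) = - x"
    and "2 < DIM('a)" "norm p = 1" "0 < \<epsilon>"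
  obtains a b where "complex_line_circle J a b" "\<And>t. dist (complex_circle J a b t) p < \<epsilon>"
proof -
  have "dim {p, J p} \<le> card {p, J p}"
    by (rule dim_le_card') simp
  also have "\<dots> \<le> 2" by (simp add: card_insert_if)
  finally have "dim {p, J p} < DIM('a)" using assms(4) by simp
  then obtain v where v: "v \<noteq> 0" "\<And>y. y \<in> span {p, J p} \<Longrightarrow> orthogonal v y"
    using orthogonal_to_subspace_exists by blast
  define w where "w = sgn v"
  have w: "norm w = 1" "p \<bullet> w = 0" "p \<bullet> J w = 0"
    using v(1) v(2)[of p] v(2)[of "J p"] assms(2)[of p w]
    by (simp_all add: w_def norm_sgn sgn_div_norm orthogonal_def span_base inner_commute)
  have Jw: "norm (J w) = 1"
    using assms(2)[of w "J w"] w(1) by (simp add: norm_eq_1 assms(3))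
  \<comment> \<open>This expression will bound the distance from \<open>p\<close> to every point of
    the circle. Keeping \<tau> below \<open>pi\<close> makes \<open>sin \<tau>\<close> positive,
    hence \<open>b\<close> nonzero.\<close>
  have "((\<lambda>\<tau>. \<bar>cos \<tau> - 1\<bar> + 2 * \<bar>sin \<tau>\<bar>) \<longlongrightarrow> \<bar>cos 0 - 1\<bar> + 2 * \<bar>sin 0\<bar>) (at_right (0::real))"
    by (intro tendsto_intros)
  then have "\<forall>\<^sub>F \<tau> in at_right 0. \<bar>cos \<tau> - 1\<bar> + 2 * \<bar>sin \<tau>\<bar> < \<epsilon>"
    using assms(6) by (auto dest: order_tendstoD(2))
  moreover have "\<forall>\<^sub>F \<tau> in at_right 0. \<tau> \<in> {0<..<pi}"
    by (rule eventually_at_right_real) simp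
  ultimately have "\<forall>\<^sub>F \<tau> in at_right 0. \<bar>cos \<tau> - 1\<bar> + 2 * \<bar>sin \<tau>\<bar> < \<epsilon> \<and> \<tau> \<in> {0<..<pi}"
    by (rule eventually_conj)
  then obtain \<tau> where \<tau>: "\<bar>cos \<tau> - 1\<bar> + 2 * \<bar>sin \<tau>\<bar> < \<epsilon>" "0 < \<tau>" "\<tau> < pi"
    using eventually_happens[of _ "at_right (0::real)"] trivial_limit_at_right_real by fastforce
  have "0 < sin \<tau>" using \<tau> by (simp add: sin_gt_zero)
  define a where "a = cos \<tau> *\<^sub>R p"
  define b where "b = sin \<tau> *\<^sub>R w"
  have Jb: "J b = sin \<tau> *\<^sub>R J w"
    by (simp add: b_def linear_cmul[OF assms(1)])
  show thesis
  proof
    show "complex_line_circle J a b"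
    proof
      show "b \<noteq> 0" using \<open>0 < sin \<tau>\<close> w(1) by (auto simp: b_def)
      have "p \<bullet> p = 1" "w \<bullet> w = 1" using assms(5) w(1) by (simp_all add: norm_eq_1)
      then show "a \<bullet> a + b \<bullet> b = 1"
        by (simp add: a_def b_def flip: power2_eq_square)
    qed (use assms(2,3) w in \<open>auto simp: a_def b_def linear_cmul[OF assms(1)] linear_add[OF assms(1)]\<close>)
    show "dist (complex_circle J a b t) p < \<epsilon>" for t
    proof -
      have "complex_circle J a b t - p
          = (cos \<tau> - 1) *\<^sub>R p + (cos t * sin \<tau>) *\<^sub>R w + (sin t * sin \<tau>) *\<^sub>R J w"
        by (simp add: complex_circle_def a_def b_def Jb[unfolded b_def] algebra_simps)
      then have "dist (complex_circle J a b t) p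
          \<le> norm ((cos \<tau> - 1) *\<^sub>R p) + norm ((cos t * sin \<tau>) *\<^sub>R w) + norm ((sin t * sin \<tau>) *\<^sub>R J w)"
        by (simp only: dist_norm)
          (intro order_trans[OF norm_triangle_ineq] add_right_mono norm_triangle_ineq)
      also have "\<dots> = \<bar>cos \<tau> - 1\<bar> + \<bar>cos t\<bar> * \<bar>sin \<tau>\<bar> + \<bar>sin t\<bar> * \<bar>sin \<tau>\<bar>"
        using assms(5) w(1) Jw by (simp add: abs_mult)
      also have "\<dots> \<le> \<bar>cos \<tau> - 1\<bar> + 1 * \<bar>sin \<tau>\<bar> + 1 * \<bar>sin \<tau>\<bar>"
        by (intro add_mono mult_right_mono) auto
      also have "\<dots> < \<epsilon>" using \<tau>(1) by simp
      finally show ?thesis .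
    qed
  qed
qed

section \<open>Rolle's theorem against straight geodesics\<close>

theorem theorem8p7:
  fixes m :: nat and K :: real and W :: "real ^ 'n \<Rightarrow> real ^ 'n"
  assumes "2 \<le> m" and "0 < K"
    and "CARD('n) = 2 * m" and "CARD('k::finite) = 2 * m - 1"
    and "killing_field (round_metric K) W"
    and "\<forall>x\<in>sphere 0 1. round_metric K x (W x) (W x) = 1"
  shows "\<not> projectively_flat TYPE(real ^ 'k)
           (kropina_metric (round_metric K) W) (kropina_domain (round_metric K) W)"
proof
  let ?F = "kropina_metric (round_metric K) W" and ?A = "kropina_domain (round_metric K) W"
  assume flat: "projectively_flat TYPE(real ^ 'k) ?F ?A"
  obtain J where J: "linear J" "\<And>x y. J x \<bullet> y = - (x \<bullet> J y)" "\<And>x. J (J x) = - x"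
    and W: "\<And>x. norm x = 1 \<Longrightarrow> W x = sqrt K *\<^sub>R J x"
    using unit_killing_field_complex_structure[OF assms(5,2,6)] by metis
  \<comment> \<open>Every point of the sphere has small closed geodesics nearby, so any
    \<open>p\<close> will do.\<close>
  obtain p :: "real ^ 'n" where p: "norm p = 1"
    using vector_choose_size[of 1] by auto
  then obtain U V \<phi> and \<psi> :: "real ^ 'k \<Rightarrow> real ^ 'n"
    where chart: "sphere_chart U V \<phi> \<psi>" and "p \<in> U"
      and straight: "\<And>c s s'. is_geodesic (coord_metric \<psi> ?F) (coord_domain V \<psi> ?A) c s s' \<Longrightarrow>
        collinear (c ` {s<..<s'})"
    using flat unfolding projectively_flat_def by (metis mem_sphere_0)
  obtain \<epsilon> where "0 < \<epsilon>" and \<epsilon>: "\<And>x. norm x = 1 \<Longrightarrow> dist x p < \<epsilon> \<Longrightarrow> x \<in> U"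
    using chart \<open>p \<in> U\<close> unfolding sphere_chart_def openin_euclidean_subtopology_iff
    by (metis mem_sphere_0)
  have "2 < DIM(real ^ 'n)" using assms(1,3) by simp
  from small_complex_line_circle[OF J this p \<open>0 < \<epsilon>\<close>]
  obtain a b where "complex_line_circle J a b"
    and near: "\<And>t. dist (complex_circle J a b t) p < \<epsilon>"
    by blast
  then interpret complex_line_circle J a b by simp
  define c where "c t = \<phi> (sgn (\<gamma> t))" for t
  have "range \<gamma> \<subseteq> U" using near \<epsilon> norm_circle by auto
  \<comment> \<open>The open interval from 0 to 10 contains the full closed period from 1 to
    \<open>1 + 2 * pi\<close>, since \<open>pi < 4\<close>.\<close>
  then have geodesic: "is_geodesic (coord_metric \<psi> ?F) (coord_domain V \<psi> ?A) c 0 10"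
    unfolding c_def using chart_circle_is_geodesic[OF chart assms(2) _ W] assms(2) by simp
  have "smooth_on {0<..<10} c"
    using geodesic by (simp add: is_geodesic_def)
  then have "Ck_on (Suc 0) {0<..<10} c"
    by (simp only: smooth_on_def)
  then have c': "(c has_vector_derivative vector_derivative c (at t)) (at t)" if "t \<in> {0<..<10}" for t
    using that by (auto simp flip: vector_derivative_works)
  have "c 1 = c (1 + 2 * pi)"
    by (simp add: c_def complex_circle_def sin_add cos_add)
  moreover have "{1..1 + 2 * pi} \<subseteq> {0<..<10}"
    using pi_less_4 by auto
  ultimately obtain t where t: "t \<in> {1<..<1 + 2 * pi}" "vector_derivative c (at t) = 0"
    using collinear_closed_curve_critical_point[OF straight[OF geodesic] _ _ _ _ c', of 1 "1 + 2 * pi"]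
    by auto
  then have "t \<in> {0<..<10}" using pi_less_4 by auto
  then have "(c t, vector_derivative c (at t)) \<in> coord_domain V \<psi> ?A"
    using geodesic unfolding is_geodesic_def by blast
  \<comment> \<open>A zero velocity would be admissible at \<open>c t\<close>. But \<psi> maps it to
    the zero vector, whose product with \<open>W\<close> is not positive.\<close>
  then have "(c t, 0) \<in> coord_domain V \<psi> ?A"
    by (simp only: t(2))
  then have "c t \<in> V" "(\<psi> (c t), frechet_derivative \<psi> (at (c t)) 0) \<in> ?A"
    by (simp_all add: coord_domain_def)
  moreover have "Ck_on (Suc 0) V \<psi>"
    using chart by (simp only: sphere_chart_def smooth_on_def)
  then have "frechet_derivative \<psi> (at (c t)) 0 = 0"
    using linear_0[OF has_derivative_linear[OF Ck_on_Suc_has_derivative]] \<open>c t \<in> V\<close> by blast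
  ultimately show False
    by (simp add: kropina_domain_def round_metric_def)
qed

end
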